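(* Let $m\ge 0$ be an integer, let $E,B$ be edge-path connected simplicial complexes and let $p:E\to B$ be a simplicial fibration. Then $\mathrm{hsecat}_m(p)=\mathrm{secat}_m(p)$.
   Context: Simplicial complexes are abstract simplicial complexes. Simplicial maps $f,g:A\to B$ are contiguous, $f\sim_c g$, if for every simplex $\{v_0,\dots,v_k\}$ of $A$ the set $\{f(v_0),\dots,f(v_k),g(v_0),\dots,g(v_k)\}$ is a simplex of $B$. They are in the same contiguity class, $f\sim g$, if there is a finite sequence of simplicial maps $f=f_0\sim_c f_1\sim_c\dots\sim_c f_n=g$ from $A$ to $B$. A simplicial map $p:E\to B$ is a simplicial fibration if for every simplicial complex $K$, all simplicial maps $\varphi,\psi:K\to B$ in the same contiguity class via a sequence $\varphi=\phi_0\sim_c\dots\sim_c\phi_\ell=\psi$, and every simplicial map $\tilde\varphi:K\to E$ with $p\circ\tilde\varphi=\varphi$, there are a simplicial map $\tilde\psi:K\to E$ and a sequence of simplicial maps $\tilde\varphi=\tilde\phi_0\sim_c\dots\sim_c\tilde\phi_\ell=\tilde\psi$ with $p\circ\tilde\phi_i=\phi_i$ for $0\le i\le\ell$. For a simplicial map $\phi:K\to L$, the $m$-simplicial Svarc genus $\mathrm{secat}_m(\phi)$ is the least integer $n\ge 0$ such that $L$ is covered by subcomplexes $L_0,\dots,L_n$ with the property that for each $j$ and every simplicial map $\eta:P\to L_j$ from an $m$-dimensional simplicial complex $P$, there is a simplicial map $s:P\to K$ with $\phi\circ s=\iota_j\circ\eta$, where $\iota_j:L_j\hookrightarrow L$ is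 the inclusion. The $m$-homotopy simplicial Svarc genus $\mathrm{hsecat}_m(\phi)$ is defined in the same way with the condition $\phi\circ s=\iota_j\circ\eta$ replaced by $\phi\circ s\sim\iota_j\circ\eta$. Both are $\infty$ if no such cover exists. *)

theory Defs
  imports Main "HOL-Library.Extended_Nat"
begin

text \<open>A complex is its set of simplices. A simplicial map is a total function on the vertex type of
  which only the values on actual vertices matter, so equality of maps is agreement on vertices.
  The inclusion of a subcomplex is the identity on vertices and is left implicit.\<close>

definition simplicial_complex :: "'a set set \<Rightarrow> bool" where
  "simplicial_complex K \<longleftrightarrow>
     (\<forall>\<sigma>\<in>K. finite \<sigma> \<and> \<sigma> \<noteq> {} \<and> (\<forall>\<tau>. \<tau> \<subseteq> \<sigma> \<and> \<tau> \<noteq> {} \<longrightarrow> \<tau> \<in> K))"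

abbreviation vertices :: "'a set set \<Rightarrow> 'a set" where
  "vertices K \<equiv> \<Union>K"

definition subcomplex :: "'a set set \<Rightarrow> 'a set set \<Rightarrow> bool" where
  "subcomplex L' L \<longleftrightarrow> simplicial_complex L' \<and> L' \<subseteq> L"

definition has_dimension :: "'a set set \<Rightarrow> nat \<Rightarrow> bool" where
  "has_dimension K m \<longleftrightarrow> (\<forall>\<sigma>\<in>K. card \<sigma> \<le> m + 1) \<and> (\<exists>\<sigma>\<in>K. card \<sigma> = m + 1)"

definition edge_path_connected :: "'a set set \<Rightarrow> bool" where
  "edge_path_connected K \<longleftrightarrow>
     (\<forall>u\<in>vertices K. \<forall>v\<in>vertices K. (\<lambda>x y. {x, y} \<in> K)\<^sup>*\<^sup>* u v)"

definition simplicial_map :: "'a set set \<Rightarrow> 'b set set \<Rightarrow> ('a \<Rightarrow> 'b) \<Rightarrow> bool" where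
  "simplicial_map A B f \<longleftrightarrow> (\<forall>\<sigma>\<in>A. f ` \<sigma> \<in> B)"

definition contiguous :: "'a set set \<Rightarrow> 'b set set \<Rightarrow> ('a \<Rightarrow> 'b) \<Rightarrow> ('a \<Rightarrow> 'b) \<Rightarrow> bool" where
  "contiguous A B f g \<longleftrightarrow>
     simplicial_map A B f \<and> simplicial_map A B g \<and> (\<forall>\<sigma>\<in>A. f ` \<sigma> \<union> g ` \<sigma> \<in> B)"

definition contiguity_sequence ::
    "'a set set \<Rightarrow> 'b set set \<Rightarrow> nat \<Rightarrow> (nat \<Rightarrow> 'a \<Rightarrow> 'b) \<Rightarrow> bool" where
  "contiguity_sequence A B l \<phi> \<longleftrightarrow>
     (\<forall>i\<le>l. simplicial_map A B (\<phi> i)) \<and> (\<forall>i<l. contiguous A B (\<phi> i) (\<phi> (Suc i)))"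

definition same_contiguity_class ::
    "'a set set \<Rightarrow> 'b set set \<Rightarrow> ('a \<Rightarrow> 'b) \<Rightarrow> ('a \<Rightarrow> 'b) \<Rightarrow> bool" where
  "same_contiguity_class A B f g \<longleftrightarrow>
     (\<exists>l \<phi>. contiguity_sequence A B l \<phi> \<and> \<phi> 0 = f \<and> \<phi> l = g)"


text \<open>The fibration property tested on a single complex \<open>K\<close>.\<close>

definition contiguity_lifting ::
    "'e set set \<Rightarrow> 'b set set \<Rightarrow> ('e \<Rightarrow> 'b) \<Rightarrow> 'k set set \<Rightarrow> bool" where
  "contiguity_lifting E B p K \<longleftrightarrow>
     (\<forall>l \<phi> f. contiguity_sequence K B l \<phi> \<and> simplicial_map K E f \<and>
        (\<forall>v\<in>vertices K. p (f v) = \<phi> 0 v) \<longrightarrow>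
        (\<exists>\<Phi>. contiguity_sequence K E l \<Phi> \<and> (\<forall>v\<in>vertices K. \<Phi> 0 v = f v) \<and>
             (\<forall>i\<le>l. \<forall>v\<in>vertices K. p (\<Phi> i v) = \<phi> i v)))"

text \<open>HOL cannot quantify over complexes \<open>K\<close> with vertices in all types inside a definition. It is
  enough to let the vertices of \<open>K\<close> range over \<open>'e \<times> 'b\<close>; lemma \<open>simplicial_fibration_lifting\<close>
  below derives the lifting property for complexes over every other type.\<close>

definition simplicial_fibration :: "'e set set \<Rightarrow> 'b set set \<Rightarrow> ('e \<Rightarrow> 'b) \<Rightarrow> bool" where
  "simplicial_fibration E B p \<longleftrightarrow> simplicial_map E B p \<and>
     (\<forall>K :: ('e \<times> 'b) set set. simplicial_complex K \<longrightarrow> contiguity_lifting E B p K)"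


text \<open>In the next two definitions \<open>L'\<close> is a subcomplex of the target \<open>L\<close> of
  \<open>\<phi> : K \<rightarrow> L\<close>, and the condition is tested on a single complex \<open>P\<close>.\<close>

definition lifts_maps_from ::
    "'a set set \<Rightarrow> ('a \<Rightarrow> 'b) \<Rightarrow> 'b set set \<Rightarrow> 'p set set \<Rightarrow> bool" where
  "lifts_maps_from K \<phi> L' P \<longleftrightarrow>
     (\<forall>\<eta>. simplicial_map P L' \<eta> \<longrightarrow>
        (\<exists>s. simplicial_map P K s \<and> (\<forall>v\<in>vertices P. \<phi> (s v) = \<eta> v)))"

definition hlifts_maps_from ::
    "'a set set \<Rightarrow> 'b set set \<Rightarrow> ('a \<Rightarrow> 'b) \<Rightarrow> 'b set set \<Rightarrow> 'p set set \<Rightarrow> bool" where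
  "hlifts_maps_from K L \<phi> L' P \<longleftrightarrow>
     (\<forall>\<eta>. simplicial_map P L' \<eta> \<longrightarrow>
        (\<exists>s. simplicial_map P K s \<and> same_contiguity_class P L (\<phi> \<circ> s) \<eta>))"

text \<open>The infimum of the empty set in \<^typ>\<open>enat\<close> is \<open>\<infinity>\<close>.\<close>

definition cover_number :: "'b set set \<Rightarrow> ('b set set \<Rightarrow> bool) \<Rightarrow> enat" where
  "cover_number L good =
     Inf {enat n | n. \<exists>C :: nat \<Rightarrow> 'b set set.
            (\<forall>j\<le>n. subcomplex (C j) L \<and> good (C j)) \<and> L = (\<Union>j\<le>n. C j)}"

text \<open>Again \<open>P\<close> has to range over a fixed type. The type \<open>'b + nat\<close> holds a copy of the \<open>m\<close>-skeleton
  of \<open>L'\<close> next to a disjoint \<open>m\<close>-simplex, which is enough: see lemmas \<open>lifts_maps_from_all\<close> and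
  \<open>hlifts_maps_from_all\<close>.\<close>

definition secat :: "nat \<Rightarrow> 'a set set \<Rightarrow> 'b set set \<Rightarrow> ('a \<Rightarrow> 'b) \<Rightarrow> enat" where
  "secat m K L \<phi> = cover_number L (\<lambda>L'.
     \<forall>P :: ('b + nat) set set.
       simplicial_complex P \<and> has_dimension P m \<longrightarrow> lifts_maps_from K \<phi> L' P)"

definition hsecat :: "nat \<Rightarrow> 'a set set \<Rightarrow> 'b set set \<Rightarrow> ('a \<Rightarrow> 'b) \<Rightarrow> enat" where
  "hsecat m K L \<phi> = cover_number L (\<lambda>L'.
     \<forall>P :: ('b + nat) set set.
       simplicial_complex P \<and> has_dimension P m \<longrightarrow> hlifts_maps_from K L \<phi> L' P)"


subsection \<open>Independence of the test types\<close>

lemma face: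
  "simplicial_complex C \<Longrightarrow> \<sigma> \<in> C \<Longrightarrow> \<tau> \<subseteq> \<sigma> \<Longrightarrow> \<tau> \<noteq> {} \<Longrightarrow> \<tau> \<in> C"
  unfolding simplicial_complex_def by blast

lemma simplicial_map_comp:
  "simplicial_map A B f \<Longrightarrow> simplicial_map B C g \<Longrightarrow> simplicial_map A C (g \<circ> f)"
  unfolding simplicial_map_def by (metis image_comp)

lemma contiguous_comp:
  assumes "simplicial_map A B h" "contiguous B C f g"
  shows "contiguous A C (f \<circ> h) (g \<circ> h)"
proof -
  have "(f \<circ> h) ` \<sigma> \<union> (g \<circ> h) ` \<sigma> \<in> C" if "\<sigma> \<in> A" for \<sigma>
    using assms that unfolding contiguous_def simplicial_map_def by (metis image_comp)
  with assms show ?thesis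
    unfolding contiguous_def by (auto intro: simplicial_map_comp)
qed

lemma contiguity_sequence_comp:
  assumes "simplicial_map A B h" "contiguity_sequence B C l \<phi>"
  shows "contiguity_sequence A C l (\<lambda>i. \<phi> i \<circ> h)"
  using assms unfolding contiguity_sequence_def
  by (auto intro: simplicial_map_comp contiguous_comp)

lemma contiguous_cong:
  assumes "contiguous A B f g" "\<forall>v\<in>vertices A. f' v = f v" "\<forall>v\<in>vertices A. g' v = g v"
  shows "contiguous A B f' g'"
proof -
  have "f' ` \<sigma> = f ` \<sigma>" "g' ` \<sigma> = g ` \<sigma>" if "\<sigma> \<in> A" for \<sigma>
    using assms(2,3) that by (auto intro!: image_cong)
  with assms(1) show ?thesis
    unfolding contiguous_def simplicial_map_def by simp
qed

lemma lifting_one_step: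
  fixes E :: "'e set set" and B :: "'b set set" and K :: "'k set set"
  assumes E: "simplicial_complex E" and B: "simplicial_complex B"
    and p: "simplicial_fibration E B p"
    and c: "contiguous K B g0 g1" and f: "simplicial_map K E f"
    and K: "simplicial_complex K"
    and pf: "\<forall>v\<in>vertices K. p (f v) = g0 v"
  shows "\<exists>f1. contiguous K E f f1 \<and> (\<forall>v\<in>vertices K. p (f1 v) = g1 v)"
proof -
  define U where "U = {\<sigma> :: ('e \<times> 'b) set. finite \<sigma> \<and> fst ` \<sigma> \<in> E \<and> snd ` \<sigma> \<in> B \<and>
      (p \<circ> fst) ` \<sigma> \<union> snd ` \<sigma> \<in> B}"
  have U: "simplicial_complex U"
    unfolding simplicial_complex_def
  proof (intro ballI conjI allI impI)
    fix \<sigma> assume s: "\<sigma> \<in> U"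
    show "finite \<sigma>" using s by (simp add: U_def)
    show "\<sigma> \<noteq> {}" using s E by (auto simp: U_def simplicial_complex_def)
    fix \<tau> assume t: "\<tau> \<subseteq> \<sigma> \<and> \<tau> \<noteq> {}"
    have "fst ` \<tau> \<in> E" using s t by - (rule face[OF E, of "fst ` \<sigma>"], auto simp: U_def)
    moreover have "snd ` \<tau> \<in> B" using s t by - (rule face[OF B, of "snd ` \<sigma>"], auto simp: U_def)
    moreover have "(p \<circ> fst) ` \<tau> \<union> snd ` \<tau> \<in> B"
      using s t by - (rule face[OF B, of "(p \<circ> fst) ` \<sigma> \<union> snd ` \<sigma>"], auto simp: U_def)
    ultimately show "\<tau> \<in> U" using s t by (auto simp: U_def intro: finite_subset)
  qed
  have fst: "simplicial_map U E fst" and snd: "simplicial_map U B snd"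
    by (auto simp: U_def simplicial_map_def)
  have pm: "simplicial_map E B p" using p by (simp add: simplicial_fibration_def)
  have c1: "contiguous U B (p \<circ> fst) snd"
    unfolding contiguous_def using simplicial_map_comp[OF fst pm] snd by (auto simp: U_def)
  define \<phi> where "\<phi> = (\<lambda>i::nat. if i = 0 then p \<circ> fst else (snd :: 'e \<times> 'b \<Rightarrow> 'b))"
  have seq: "contiguity_sequence U B 1 \<phi>"
    using c1 unfolding contiguity_sequence_def \<phi>_def contiguous_def by auto
  have "contiguity_lifting E B p U" using p U by (simp add: simplicial_fibration_def)
  from this[unfolded contiguity_lifting_def, rule_format, of 1 \<phi> fst] seq fst obtain \<Phi> where \<Phi>: "contiguity_sequence U E 1 \<Phi>" "\<forall>v\<in>vertices U. \<Phi> 0 v = fst v"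
    "\<forall>i\<le>1. \<forall>v\<in>vertices U. p (\<Phi> i v) = \<phi> i v"
    by (auto simp: \<phi>_def)
  define h where "h = (\<lambda>v. (f v, g1 v))"
  have h: "simplicial_map K U h"
    unfolding simplicial_map_def
  proof
    fix \<sigma> assume s: "\<sigma> \<in> K"
    have 1: "fst ` h ` \<sigma> = f ` \<sigma>" "snd ` h ` \<sigma> = g1 ` \<sigma>" by (auto simp: h_def image_image)
    have 2: "(p \<circ> fst) ` h ` \<sigma> = g0 ` \<sigma>"
      using pf s by (auto simp: h_def image_image intro!: image_cong)
    have "finite \<sigma>" using s K by (simp add: simplicial_complex_def)
    moreover have "f ` \<sigma> \<in> E" using f s by (simp add: simplicial_map_def)
    moreover have "g1 ` \<sigma> \<in> B" "g0 ` \<sigma> \<union> g1 ` \<sigma> \<in> B"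
      using c s by (simp_all add: contiguous_def simplicial_map_def)
    ultimately show "h ` \<sigma> \<in> U" unfolding U_def using 1 2 by simp
  qed
  have hv: "\<Phi> 0 (h v) = fst (h v)" "p (\<Phi> 1 (h v)) = \<phi> 1 (h v)" if "v \<in> vertices K" for v
  proof -
    have "h v \<in> vertices U" using h that unfolding simplicial_map_def by blast
    then show "\<Phi> 0 (h v) = fst (h v)" "p (\<Phi> 1 (h v)) = \<phi> 1 (h v)" using \<Phi>(2,3) by blast+
  qed
  have "contiguous U E (\<Phi> 0) (\<Phi> 1)" using \<Phi>(1) by (simp add: contiguity_sequence_def)
  from contiguous_comp[OF h this] have "contiguous K E (\<Phi> 0 \<circ> h) (\<Phi> 1 \<circ> h)" .
  moreover have "\<forall>v\<in>vertices K. f v = (\<Phi> 0 \<circ> h) v"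
    using hv(1) by (metis comp_apply fst_conv h_def)
  ultimately have "contiguous K E f (\<Phi> 1 \<circ> h)" by (auto intro: contiguous_cong)
  moreover have "\<forall>v\<in>vertices K. p ((\<Phi> 1 \<circ> h) v) = g1 v"
    using hv(2) by (simp add: h_def \<phi>_def)
  ultimately show ?thesis by blast
qed

lemma simplicial_fibration_lifting:
  fixes E :: "'e set set" and B :: "'b set set" and K :: "'k set set"
  assumes E: "simplicial_complex E" and B: "simplicial_complex B"
    and p: "simplicial_fibration E B p" and K: "simplicial_complex K"
  shows "contiguity_lifting E B p K"
  unfolding contiguity_lifting_def
proof (intro allI impI, elim conjE)
  fix l \<phi> f
  assume "contiguity_sequence K B l \<phi>" "simplicial_map K E f" "\<forall>v\<in>vertices K. p (f v) = \<phi> 0 v"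
  then show "\<exists>\<Phi>. contiguity_sequence K E l \<Phi> \<and> (\<forall>v\<in>vertices K. \<Phi> 0 v = f v) \<and>
             (\<forall>i\<le>l. \<forall>v\<in>vertices K. p (\<Phi> i v) = \<phi> i v)"
  proof (induction l)
    case 0
    then show ?case by (intro exI[of _ "\<lambda>_. f"]) (auto simp: contiguity_sequence_def)
  next
    case (Suc l)
    then have "contiguity_sequence K B l \<phi>" by (simp add: contiguity_sequence_def)
    with Suc obtain \<Phi> where \<Phi>: "contiguity_sequence K E l \<Phi>" "\<forall>v\<in>vertices K. \<Phi> 0 v = f v"
      "\<forall>i\<le>l. \<forall>v\<in>vertices K. p (\<Phi> i v) = \<phi> i v" by blast
    have "contiguous K B (\<phi> l) (\<phi> (Suc l))" using Suc.prems(1) by (simp add: contiguity_sequence_def)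
    moreover have "simplicial_map K E (\<Phi> l)" using \<Phi>(1) by (simp add: contiguity_sequence_def)
    ultimately obtain f1 where f1: "contiguous K E (\<Phi> l) f1" "\<forall>v\<in>vertices K. p (f1 v) = \<phi> (Suc l) v"
      using lifting_one_step[OF E B p _ _ K] \<Phi>(3) by blast
    have "contiguity_sequence K E (Suc l) (\<Phi>(Suc l := f1))"
      using \<Phi>(1) f1(1) unfolding contiguity_sequence_def contiguous_def
      by (auto simp: le_Suc_eq less_Suc_eq)
    then show ?case
      using \<Phi>(2,3) f1(2)
      by (intro exI[of _ "\<Phi>(Suc l := f1)"] conjI) (assumption, auto simp: le_Suc_eq)
  qed
qed

lemma universal_test_complex:
  fixes L' :: "'b set set" and P :: "'p set set"
  assumes L': "simplicial_complex L'" and P: "simplicial_complex P" "has_dimension P m"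
    and \<eta>: "simplicial_map P L' \<eta>"
  obtains Q :: "('b + nat) set set" and \<theta> h
  where "simplicial_complex Q" "has_dimension Q m" "simplicial_map Q L' \<theta>"
    "simplicial_map P Q h" "\<theta> \<circ> h = \<eta>"
proof -
  obtain \<sigma> where \<sigma>: "\<sigma> \<in> P" using P(2) by (auto simp: has_dimension_def)
  then have "\<sigma> \<noteq> {}" using P(1) by (simp add: simplicial_complex_def)
  then obtain v where v: "v \<in> \<sigma>" by blast
  define b where "b = \<eta> v"
  have "\<eta> ` \<sigma> \<in> L'" using \<eta> \<sigma> by (simp add: simplicial_map_def)
  then have b: "{b} \<in> L'" using face[OF L', of "\<eta> ` \<sigma>" "{b}"] v by (simp add: b_def)
  define S where "S = (\<lambda>\<sigma>. Inl ` \<sigma> :: ('b + nat) set) ` {\<sigma>\<in>L'. card \<sigma> \<le> m + 1}"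
  define T where "T = (\<lambda>\<tau>. Inr ` \<tau> :: ('b + nat) set) ` (Pow {..m} - {{}})"
  define \<theta> where "\<theta> = (\<lambda>x :: 'b + nat. case x of Inl y \<Rightarrow> y | Inr _ \<Rightarrow> b)"
  show thesis
  proof (rule that[of "S \<union> T" \<theta> "Inl \<circ> \<eta>"])
    show "simplicial_complex (S \<union> T)"
      unfolding simplicial_complex_def
    proof (intro ballI conjI allI impI)
      fix s assume s: "s \<in> S \<union> T"
      show "finite s" "s \<noteq> {}"
        using s L' by (auto simp: S_def T_def simplicial_complex_def intro: finite_subset)
      fix t assume t: "t \<subseteq> s \<and> t \<noteq> {}"
      show "t \<in> S \<union> T"
      proof (cases "s \<in> S")
        case True
        then obtain r where r: "r \<in> L'" "card r \<le> m + 1" "s = Inl ` r" by (auto simp: S_def)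
        obtain q where q: "q \<subseteq> r" "t = Inl ` q" using t r(3) by (meson subset_imageE)
        have "finite r" using r(1) L' by (simp add: simplicial_complex_def)
        then have "card q \<le> m + 1" using card_mono[OF _ q(1)] r(2) by linarith
        moreover have "q \<in> L'" using face[OF L' r(1) q(1)] q(2) t by simp
        ultimately show ?thesis using q(2) by (auto simp: S_def)
      next
        case False
        then obtain r where r: "r \<subseteq> {..m}" "s = Inr ` r" using s by (auto simp: T_def)
        obtain q where q: "q \<subseteq> r" "t = Inr ` q" using t r(2) by (meson subset_imageE)
        then have "q \<in> Pow {..m} - {{}}" using r(1) t by auto
        then show ?thesis using q(2) by (auto simp: T_def)
      qed
    qed
    show "has_dimension (S \<union> T) m"
      unfolding has_dimension_def
    proof
      have "card q \<le> Suc m" if "q \<subseteq> {..m}" for q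
        using card_mono[OF _ that] by simp
      then show "\<forall>s\<in>S \<union> T. card s \<le> m + 1"
        by (auto simp: S_def T_def card_image)
      have "{..m} \<in> Pow {..m} - {{}}" by auto
      then have "Inr ` {..m} \<in> T" unfolding T_def by blast
      moreover have "card (Inr ` {..m} :: ('b + nat) set) = m + 1" by (simp add: card_image)
      ultimately show "\<exists>s\<in>S \<union> T. card s = m + 1" by blast
    qed
    show "simplicial_map (S \<union> T) L' \<theta>"
      unfolding simplicial_map_def
    proof
      fix s assume "s \<in> S \<union> T"
      then consider r where "r \<in> L'" "s = Inl ` r" | r where "r \<noteq> {}" "s = Inr ` r"
        by (auto simp: S_def T_def)
      then show "\<theta> ` s \<in> L'"
        using b by cases (auto simp: \<theta>_def image_image image_constant_conv)
    qed
    show "simplicial_map P (S \<union> T) (Inl \<circ> \<eta>)"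
      unfolding simplicial_map_def
    proof
      fix s assume s: "s \<in> P"
      have "finite s" using s P(1) by (simp add: simplicial_complex_def)
      moreover have "card s \<le> m + 1" using s P(2) by (simp add: has_dimension_def)
      ultimately have "card (\<eta> ` s) \<le> m + 1" using card_image_le[of s \<eta>] by linarith
      moreover have "\<eta> ` s \<in> L'" using \<eta> s by (simp add: simplicial_map_def)
      ultimately have "Inl ` \<eta> ` s \<in> S" unfolding S_def by blast
      then show "(Inl \<circ> \<eta>) ` s \<in> S \<union> T" by (simp add: image_comp)
    qed
    show "\<theta> \<circ> (Inl \<circ> \<eta>) = \<eta>" by (auto simp: \<theta>_def)
  qed
qed

lemma lifts_maps_from_all:
  fixes K :: "'a set set" and L' :: "'b set set" and P :: "'p set set"
  assumes L': "simplicial_complex L'"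
    and all: "\<forall>Q :: ('b + nat) set set.
       simplicial_complex Q \<and> has_dimension Q m \<longrightarrow> lifts_maps_from K \<phi> L' Q"
    and P: "simplicial_complex P" "has_dimension P m"
  shows "lifts_maps_from K \<phi> L' P"
  unfolding lifts_maps_from_def
proof (intro allI impI)
  fix \<eta> assume \<eta>: "simplicial_map P L' \<eta>"
  obtain Q :: "('b + nat) set set" and \<theta> h where Q: "simplicial_complex Q" "has_dimension Q m"
    "simplicial_map Q L' \<theta>" "simplicial_map P Q h" "\<theta> \<circ> h = \<eta>"
    by (rule universal_test_complex[OF L' P \<eta>])
  obtain s where s: "simplicial_map Q K s" "\<forall>v\<in>vertices Q. \<phi> (s v) = \<theta> v"
    using all Q(1-3) unfolding lifts_maps_from_def by blast
  have "h v \<in> vertices Q" if "v \<in> vertices P" for v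
    using Q(4) that unfolding simplicial_map_def by blast
  then have "\<forall>v\<in>vertices P. \<phi> ((s \<circ> h) v) = \<eta> v"
    unfolding Q(5)[symmetric] using s(2) by (metis comp_apply)
  then show "\<exists>s. simplicial_map P K s \<and> (\<forall>v\<in>vertices P. \<phi> (s v) = \<eta> v)"
    using simplicial_map_comp[OF Q(4) s(1)] by blast
qed

lemma hlifts_maps_from_all:
  fixes K :: "'a set set" and L L' :: "'b set set" and P :: "'p set set"
  assumes L': "simplicial_complex L'"
    and all: "\<forall>Q :: ('b + nat) set set.
       simplicial_complex Q \<and> has_dimension Q m \<longrightarrow> hlifts_maps_from K L \<phi> L' Q"
    and P: "simplicial_complex P" "has_dimension P m"
  shows "hlifts_maps_from K L \<phi> L' P"
  unfolding hlifts_maps_from_def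
proof (intro allI impI)
  fix \<eta> assume \<eta>: "simplicial_map P L' \<eta>"
  obtain Q :: "('b + nat) set set" and \<theta> h where Q: "simplicial_complex Q" "has_dimension Q m"
    "simplicial_map Q L' \<theta>" "simplicial_map P Q h" "\<theta> \<circ> h = \<eta>"
    by (rule universal_test_complex[OF L' P \<eta>])
  obtain s where s: "simplicial_map Q K s" "same_contiguity_class Q L (\<phi> \<circ> s) \<theta>"
    using all Q(1-3) unfolding hlifts_maps_from_def by blast
  obtain l \<psi> where "contiguity_sequence Q L l \<psi>" "\<psi> 0 = \<phi> \<circ> s" "\<psi> l = \<theta>"
    using s(2) unfolding same_contiguity_class_def by blast
  then have "contiguity_sequence P L l (\<lambda>i. \<psi> i \<circ> h)" "\<psi> 0 \<circ> h = \<phi> \<circ> (s \<circ> h)" "\<psi> l \<circ> h = \<eta>"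
    using contiguity_sequence_comp[OF Q(4)] Q(5) by (auto simp: o_assoc)
  then have "same_contiguity_class P L (\<phi> \<circ> (s \<circ> h)) \<eta>"
    unfolding same_contiguity_class_def by blast
  then show "\<exists>s. simplicial_map P K s \<and> same_contiguity_class P L (\<phi> \<circ> s) \<eta>"
    using simplicial_map_comp[OF Q(4) s(1)] by blast
qed

end

theory Submission
  imports Defs
begin

text \<open>For each subcomplex of \<open>B\<close> and each test complex the strict and the
  homotopy lifting conditions agree, so both numbers are infima over the same covers. A strict lift
  is a homotopy lift because maps equal on vertices lie in one contiguity class
  (\<open>lifts_maps_from_imp_hlifts_maps_from\<close>). Conversely, the fibration property turns a
  lift up to contiguity into a strict one
  (\<open>hlifts_maps_from_imp_lifts_maps_from\<close>).\<close>

lemma same_contiguity_class_eq_on_vertices: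
  assumes g: "simplicial_map A B g" and eq: "\<forall>v\<in>vertices A. f v = g v"
  shows "same_contiguity_class A B f g"
proof -
  have "contiguous A B g g"
    using g by (simp add: contiguous_def simplicial_map_def)
  then have c: "contiguous A B f g"
    by (rule contiguous_cong) (use eq in auto)
  \<comment> \<open>The endpoints of a sequence must be \<open>f\<close> and \<open>g\<close> as
    total functions, so one step is spent on passing between two maps that may differ off the
    vertices.\<close>
  let ?\<phi> = "\<lambda>i::nat. if i = 0 then f else g"
  have "contiguity_sequence A B 1 ?\<phi>"
    using c by (auto simp: contiguity_sequence_def contiguous_def)
  moreover have "?\<phi> 0 = f" "?\<phi> 1 = g" by simp_all
  ultimately show ?thesis
    unfolding same_contiguity_class_def by blast
qed

lemma lifts_maps_from_imp_hlifts_maps_from: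
  assumes "L' \<subseteq> L" and lift: "lifts_maps_from K \<phi> L' P"
  shows "hlifts_maps_from K L \<phi> L' P"
  unfolding hlifts_maps_from_def
proof (intro allI impI)
  fix \<eta> assume \<eta>: "simplicial_map P L' \<eta>"
  obtain s where s: "simplicial_map P K s" "\<forall>v\<in>vertices P. \<phi> (s v) = \<eta> v"
    using lift \<eta> unfolding lifts_maps_from_def by blast
  have "simplicial_map P L \<eta>"
    using \<eta> \<open>L' \<subseteq> L\<close> by (auto simp: simplicial_map_def)
  then have "same_contiguity_class P L (\<phi> \<circ> s) \<eta>"
    by (rule same_contiguity_class_eq_on_vertices) (simp add: s(2))
  with s(1) show "\<exists>s. simplicial_map P K s \<and> same_contiguity_class P L (\<phi> \<circ> s) \<eta>"
    by blast
qed

text \<open>The contiguity sequence from \<open>p \<circ> s\<close> to \<open>\<eta>\<close> lifts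
  to \<open>E\<close> starting at \<open>s\<close>; the last map of the lifted sequence lies over
  \<open>\<eta>\<close> and is the strict lift.\<close>

lemma hlifts_maps_from_imp_lifts_maps_from:
  assumes lifting: "contiguity_lifting E B p P" and hlift: "hlifts_maps_from E B p L' P"
  shows "lifts_maps_from E p L' P"
  unfolding lifts_maps_from_def
proof (intro allI impI)
  fix \<eta> assume "simplicial_map P L' \<eta>"
  then obtain s l \<psi> where s: "simplicial_map P E s"
    and \<psi>: "contiguity_sequence P B l \<psi>" "\<psi> 0 = p \<circ> s" "\<psi> l = \<eta>"
    using hlift unfolding hlifts_maps_from_def same_contiguity_class_def by blast
  have "\<forall>v\<in>vertices P. p (s v) = \<psi> 0 v" using \<psi>(2) by simp
  then obtain \<Psi> where "contiguity_sequence P E l \<Psi>" "\<forall>i\<le>l. \<forall>v\<in>vertices P. p (\<Psi> i v) = \<psi> i v"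
    using lifting[unfolded contiguity_lifting_def, rule_format, of l \<psi> s] s \<psi>(1) by auto
  then have "simplicial_map P E (\<Psi> l)" "\<forall>v\<in>vertices P. p (\<Psi> l v) = \<eta> v"
    using \<psi>(3) by (simp_all add: contiguity_sequence_def)
  then show "\<exists>s. simplicial_map P E s \<and> (\<forall>v\<in>vertices P. p (s v) = \<eta> v)"
    by blast
qed

text \<open>Agreement is asked only on subcomplexes of \<open>L\<close>, since the step from strict
  to homotopy lifts uses that a map into \<open>L'\<close> is also a map into
  \<open>L\<close>.\<close>

lemma cover_number_cong:
  assumes "\<And>L'. subcomplex L' L \<Longrightarrow> good L' = good' L'"
  shows "cover_number L good = cover_number L good'"
proof -
  have "subcomplex L' L \<and> good L' \<longleftrightarrow> subcomplex L' L \<and> good' L'" for L'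
    using assms by blast
  then show ?thesis unfolding cover_number_def by simp
qed

theorem theorem5p2:
  fixes m :: nat and E :: "'e set set" and B :: "'b set set" and p :: "'e \<Rightarrow> 'b"
  assumes "simplicial_complex E" and "simplicial_complex B"
    and "edge_path_connected E" and "edge_path_connected B"
    and "simplicial_fibration E B p"
  shows "hsecat m E B p = secat m E B p"
proof -
  have "hlifts_maps_from E B p L' P \<longleftrightarrow> lifts_maps_from E p L' P"
    if "subcomplex L' B" "simplicial_complex P" for L' and P :: "('b + nat) set set"
  proof
    assume "hlifts_maps_from E B p L' P"
    \<comment> \<open>The fibration is tested on vertices in \<open>'e \<times> 'b\<close>, while
      \<open>P\<close> has vertices in \<open>'b + nat\<close>; this lemma bridges the two
      types.\<close>
    with simplicial_fibration_lifting[OF assms(1,2,5) that(2)] show "lifts_maps_from E p L' P"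
      by (rule hlifts_maps_from_imp_lifts_maps_from)
  next
    assume "lifts_maps_from E p L' P"
    with that(1) show "hlifts_maps_from E B p L' P"
      by (auto simp: subcomplex_def intro: lifts_maps_from_imp_hlifts_maps_from)
  qed
  then show ?thesis
    unfolding hsecat_def secat_def by (intro cover_number_cong) blast
qed

end
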